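(* Let $\epsilon>0$ and let $\beta$ be a non-negative real number. Moreover, assume that $\alpha>1$ is irrational and of finite type $\tau(\alpha)\leq \frac{512}{43}-\epsilon$. Then there is a number $p_0(\alpha,\epsilon)$ such that, for all primes $p\geq p_0(\alpha,\epsilon)$ and all integers $z$ coprime to $p$, there is a point $(m,\tilde m)\in\mathscr{H}_{z\bmod p}$ with $m\in\mathcal{B}(\alpha,\beta)$ and \[ \max\{m,\tilde m\}\leq \alpha\, p^{684/727}\log p+\beta . \]
   Context: For a prime $p$ and an integer $z$ not divisible by $p$, the modular hyperbola is $\mathscr{H}_{z\bmod p}=\{(m,\tilde m)\in\mathbb{Z}^2\cap[1,p)^2 : m\tilde m\equiv z \bmod p\}$. For real $\alpha\geq 1$ and $\beta\geq 0$, the Beatty set is $\mathcal{B}(\alpha,\beta)=\{\lfloor n\alpha+\beta\rfloor : n\in\mathbb{N}\}$, where $\mathbb{N}=\{1,2,3,\ldots\}$ and $\lfloor x\rfloor$ is the largest integer less than or equal to $x$. The type of an irrational number $\alpha$ is \[ \tau(\alpha)=\sup\Bigl\{\eta\in\mathbb{R} : \liminf_{q\to\infty} q^{\eta}\,\|\alpha q\|=0\Bigr\}, \] where $q$ runs over positive integers and $\|\varrho\|=\min_{n\in\mathbb{Z}}|\varrho-n|$ is the distance to a nearest integer; $\alpha$ is of finite type if $\tau(\alpha)<\infty$. The notation $p_0(\alpha,\epsilon)$ indicates a number depending on $\alpha$ and $\epsilon$ (and not on $\beta$).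
   Formalization: The condition α + β < p is added: with p₀ independent of β the claim fails when α + β ≥ p (e.g. β = p), since then every element of the Beatty set is at least p while m < p; the condition is implied by the conclusion, so no true case is lost. *)

theory Defs
  imports "HOL-Analysis.Analysis" "HOL-Number_Theory.Number_Theory"
begin

definition modular_hyperbola :: "nat \<Rightarrow> int \<Rightarrow> (int \<times> int) set" where
  "modular_hyperbola p z =
     {(m, m'). 1 \<le> m \<and> m < int p \<and> 1 \<le> m' \<and> m' < int p \<and> [m * m' = z] (mod int p)}"

definition beatty_set :: "real \<Rightarrow> real \<Rightarrow> int set" where
  "beatty_set \<alpha> \<beta> = {\<lfloor>real n * \<alpha> + \<beta>\<rfloor> | n::nat. n \<ge> 1}"

(* infdist x \<int> is the distance from x to a nearest integer.  The supremum is taken in the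
   extended reals, so that numbers of infinite type have type \<infinity>. *)
definition irrationality_type :: "real \<Rightarrow> ereal" where
  "irrationality_type \<alpha> =
     Sup {ereal \<eta> | \<eta>::real.
            liminf (\<lambda>q::nat. ereal (real q powr \<eta> * infdist (\<alpha> * real q) \<int>)) = 0}"

(* A modular hyperbola modulo p only has abscissae below p, whereas every element of a Beatty set
   is at least the floor of \<alpha> + \<beta>.  Hence \<alpha> + \<beta> < p is necessary for the two to meet; a threshold
   for p that is uniform in \<beta> is only meaningful for such p. *)
lemma modular_hyperbola_beatty_imp_less:
  assumes "(m, m') \<in> modular_hyperbola p z" "m \<in> beatty_set \<alpha> \<beta>" "\<alpha> \<ge> 1"
  shows "\<alpha> + \<beta> < real p"
proof -
  from assms(2) obtain n :: nat where n: "n \<ge> 1" "m = \<lfloor>real n * \<alpha> + \<beta>\<rfloor>"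
    by (auto simp: beatty_set_def)
  have "m < int p"
    using assms(1) by (auto simp: modular_hyperbola_def)
  then have "real n * \<alpha> + \<beta> < real p"
    using n(2) by (simp add: floor_less_iff)
  moreover have "1 * \<alpha> \<le> real n * \<alpha>"
    using n(1) assms(3) by (intro mult_right_mono) auto
  ultimately show ?thesis by simp
qed

end

(*
  Up to a trivial case in which m = \<lfloor>\<alpha> + \<beta>\<rfloor> works, look for m = x + a + b and m' = 1 + c + d, where
  a, b, c, d run over {0..<M} and M is about X / 2 with X = \<alpha> p^(684/727) log p.  Whether m lies in the
  Beatty set depends only on m / \<alpha> mod 1, and the trigonometric polynomial
  cos(\<pi> t)^(2k) - cos(\<pi> / (2 \<alpha>))^(2k) is positive only where m does; for a suitable fixed k its mean is
  positive.  The constant term contributes a positive multiple of M^4 / p.  Each of the boundedly many other frequencies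
  contributes O(M^2 / p) from a geometric sum, because \<alpha> is irrational, and every frequency has an error
  of O(M^2 p^(3/4)): completion of the sums with the weights a + b and c + d costs no
  logarithm, by Parseval, and leaves Kloosterman sums, bounded by O(p^(3/4)) through Kloosterman's
  fourth moment argument.  Since 2 * 684 / 727 > 7 / 4, the main term dominates.
*)
theory Submission
  imports Defs "HOL-Library.Real_Mod" "HOL-Real_Asymp.Real_Asymp"
begin

section \<open>Additive characters and the modular hyperbola\<close>

text \<open>The character e(k/p) of Z/pZ, kept as a function on the integers;
  \<open>additive_char_cong\<close> supplies the periodicity modulo p.\<close>

definition additive_char :: "nat \<Rightarrow> int \<Rightarrow> complex" where
  "additive_char p k = cis (2 * pi * real_of_int k / real p)"

lemma additive_char_add: "additive_char p (k + l) = additive_char p k * additive_char p l"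
  by (simp add: additive_char_def cis_mult ring_distribs add_divide_distrib)

lemma additive_char_0 [simp]: "additive_char p 0 = 1"
  by (simp add: additive_char_def)

lemma norm_additive_char [simp]: "norm (additive_char p k) = 1"
  by (simp add: additive_char_def)

lemma cnj_additive_char: "cnj (additive_char p k) = additive_char p (- k)"
  by (simp add: additive_char_def cis_cnj)

lemma additive_char_eq_1_iff:
  assumes "p > 0"
  shows "additive_char p k = 1 \<longleftrightarrow> int p dvd k"
proof -
  have "additive_char p k = 1 \<longleftrightarrow> (\<exists>n::int. real_of_int k = real_of_int n * real p)"
    using assms by (simp add: additive_char_def cis_eq_1_iff field_simps)
  also have "\<dots> \<longleftrightarrow> (\<exists>n. k = n * int p)"
    by (metis of_int_eq_iff of_int_mult of_int_of_nat_eq)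
  finally show ?thesis by (auto simp: dvd_def mult.commute)
qed

lemma additive_char_cong:
  assumes "p > 0" "[k = l] (mod int p)"
  shows "additive_char p k = additive_char p l"
proof -
  have "additive_char p (k - l) = 1"
    using assms by (simp add: additive_char_eq_1_iff cong_iff_dvd_diff)
  then show ?thesis
    using additive_char_add[of p "k - l" l] by simp
qed

text \<open>Orthogonality: the summands are the powers of a single p-th root of unity, so the
  geometric sum vanishes unless that root is 1.\<close>

lemma sum_additive_char:
  assumes "p > 0"
  shows "(\<Sum>r\<in>{0..<int p}. additive_char p (r * k)) = (if int p dvd k then of_nat p else 0)"
proof -
  have pow: "additive_char p (int n * k) = additive_char p k ^ n" for n
    by (induction n) (simp_all add: ring_distribs additive_char_add)
  have bij: "bij_betw int {..<p} {0..<int p}"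
    by (simp add: bij_betw_def image_int_atLeastLessThan lessThan_atLeast0)
  have "(\<Sum>r\<in>{0..<int p}. additive_char p (r * k)) = (\<Sum>n<p. additive_char p k ^ n)"
    by (subst sum.reindex_bij_betw[OF bij, symmetric]) (simp add: pow)
  moreover have "additive_char p k ^ p = 1"
    using assms by (simp add: additive_char_eq_1_iff flip: pow)
  ultimately show ?thesis
    using assms by (simp add: additive_char_eq_1_iff sum_gp_strict)
qed

section \<open>Points of the modular hyperbola modulo a prime\<close>

lemma prime_cong_mult_cancel:
  assumes "prime p" "\<not> int p dvd k"
  shows "[k * a = k * b] (mod int p) \<longleftrightarrow> [a = b] (mod int p)"
  using assms by (intro cong_mult_lcancel) (metis coprime_commute prime_imp_coprime prime_nat_int_transfer)

text \<open>The ordinate is the residue of z times the inverse of x; it avoids 0 because p does not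
  divide z.\<close>

lemma modular_hyperbola_unique_ordinate:
  assumes "prime p" "coprime z (int p)" "1 \<le> x" "x < int p"
  shows "\<exists>!y. (x, y) \<in> modular_hyperbola p z"
proof -
  have nd: "\<not> int p dvd x"
    using assms(3,4) zdvd_imp_le[of "int p" x] by linarith
  then have "coprime x (int p)"
    by (metis assms(1) coprime_commute prime_imp_coprime prime_nat_int_transfer)
  then obtain y where y: "[x * y = 1] (mod int p)"
    using cong_solve_coprime_int by blast
  let ?y = "(y * z) mod int p"
  have "[x * ?y = x * (y * z)] (mod int p)"
    by (intro cong_mult) auto
  also have "x * (y * z) = (x * y) * z" by simp
  also have "[(x * y) * z = 1 * z] (mod int p)"
    using y by (intro cong_mult) auto
  finally have c: "[x * ?y = z] (mod int p)" by simp
  have "\<not> int p dvd z"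
    using assms(1,2) by (metis coprime_commute coprime_absorb_left not_prime_unit prime_nat_int_transfer)
  then have "?y \<noteq> 0"
    using c by (metis cong_dvd_iff dvd_0_right mult_zero_right)
  then have "?y \<ge> 1" "?y < int p"
    using prime_gt_0_nat[OF assms(1)] pos_mod_sign[of "int p" "y * z"]
    by (linarith, simp)
  then have "(x, ?y) \<in> modular_hyperbola p z"
    using c assms(3,4) by (simp add: modular_hyperbola_def)
  moreover have "v = w" if "(x, v) \<in> modular_hyperbola p z" "(x, w) \<in> modular_hyperbola p z" for v w
  proof -
    have "[x * v = x * w] (mod int p)"
      using that by (auto simp: modular_hyperbola_def cong_def)
    then have "[v = w] (mod int p)"
      using prime_cong_mult_cancel[OF assms(1) nd] by blast
    then show ?thesis
      using that by (auto simp: modular_hyperbola_def cong_def)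
  qed
  ultimately show ?thesis by blast
qed

lemma bij_betw_fst_modular_hyperbola:
  assumes "prime p" "coprime z (int p)"
  shows "bij_betw fst (modular_hyperbola p z) {1..<int p}"
proof -
  have "inj_on fst (modular_hyperbola p z)"
  proof (rule inj_onI)
    fix P Q assume PQ: "P \<in> modular_hyperbola p z" "Q \<in> modular_hyperbola p z" "fst P = fst Q"
    then have "1 \<le> fst P" "fst P < int p"
      by (auto simp: modular_hyperbola_def)
    then show "P = Q"
      using PQ modular_hyperbola_unique_ordinate[OF assms, of "fst P"] by (metis prod.collapse)
  qed
  moreover have "fst ` modular_hyperbola p z = {1..<int p}"
  proof
    show "{1..<int p} \<subseteq> fst ` modular_hyperbola p z"
      using modular_hyperbola_unique_ordinate[OF assms] by (force simp: image_iff)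
  qed (auto simp: modular_hyperbola_def)
  ultimately show ?thesis by (simp add: bij_betw_def)
qed

lemma bij_betw_snd_modular_hyperbola:
  assumes "prime p" "coprime z (int p)"
  shows "bij_betw snd (modular_hyperbola p z) {1..<int p}"
proof -
  have "bij_betw prod.swap (modular_hyperbola p z) (modular_hyperbola p z)"
    by (rule bij_betw_byWitness[where f' = prod.swap]) (auto simp: modular_hyperbola_def mult.commute)
  from bij_betw_trans[OF this bij_betw_fst_modular_hyperbola[OF assms]]
  show ?thesis by (simp add: comp_def)
qed

lemma finite_modular_hyperbola [simp]: "finite (modular_hyperbola p z)"
  by (rule finite_subset[of _ "{1..int p} \<times> {1..int p}"]) (auto simp: modular_hyperbola_def)

lemma card_modular_hyperbola:
  assumes "prime p" "coprime z (int p)"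
  shows "card (modular_hyperbola p z) = p - 1"
  using bij_betw_same_card[OF bij_betw_fst_modular_hyperbola[OF assms]] by simp

text \<open>Expanding the square and summing over r leaves, by orthogonality, only pairs congruent
  modulo p. The last hypothesis makes these the diagonal pairs.\<close>

lemma parseval_additive_char:
  fixes c :: "'a \<Rightarrow> complex" and X :: "'a \<Rightarrow> int"
  assumes "p > 0" "finite I" "\<And>i j. i \<in> I \<Longrightarrow> j \<in> I \<Longrightarrow> [X i = X j] (mod int p) \<Longrightarrow> i = j"
  shows "(\<Sum>r\<in>{0..<int p}. (norm (\<Sum>i\<in>I. c i * additive_char p (r * X i)))\<^sup>2)
         = real p * (\<Sum>i\<in>I. (norm (c i))\<^sup>2)"
proof -
  let ?R = "{0..<int p}"
  have square: "complex_of_real ((norm (\<Sum>i\<in>I. c i * additive_char p (r * X i)))\<^sup>2)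
      = (\<Sum>i\<in>I. \<Sum>j\<in>I. c i * cnj (c j) * additive_char p (r * (X i - X j)))" for r
    unfolding complex_norm_square cnj_sum sum_product
    by (intro sum.cong refl)
      (simp add: cnj_additive_char mult_ac additive_char_add[symmetric] right_diff_distrib)
  have "complex_of_real (\<Sum>r\<in>?R. (norm (\<Sum>i\<in>I. c i * additive_char p (r * X i)))\<^sup>2)
     = (\<Sum>r\<in>?R. \<Sum>i\<in>I. \<Sum>j\<in>I. c i * cnj (c j) * additive_char p (r * (X i - X j)))"
    unfolding of_real_sum square ..
  also have "\<dots> = (\<Sum>i\<in>I. \<Sum>j\<in>I. c i * cnj (c j) * (\<Sum>r\<in>?R. additive_char p (r * (X i - X j))))"
    by (subst sum.swap, intro sum.cong refl, subst sum.swap) (simp add: sum_distrib_left)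
  also have "\<dots> = (\<Sum>i\<in>I. \<Sum>j\<in>I. if j = i then c i * cnj (c i) * of_nat p else 0)"
    using assms by (intro sum.cong refl) (auto simp: sum_additive_char cong_iff_dvd_diff)
  also have "\<dots> = complex_of_real (real p * (\<Sum>i\<in>I. (norm (c i))\<^sup>2))"
    using assms(2) by (simp add: sum_distrib_left mult.commute flip: complex_norm_square)
  finally show ?thesis by (simp only: of_real_eq_iff)
qed

section \<open>Kloosterman sums\<close>

text \<open>Orthogonality in r and in s separately turns the second moment into a count of
  simultaneous coincidences. With pairs of hyperbola points as indices, this becomes the fourth
  moment of Kloosterman sums.\<close>

lemma sum_norm_square_additive_char_2:
  fixes X Y :: "'a \<Rightarrow> int"
  assumes "p > 0" "finite I"
  shows "(\<Sum>r\<in>{0..<int p}. \<Sum>s\<in>{0..<int p}. (norm (\<Sum>i\<in>I. additive_char p (r * X i + s * Y i)))\<^sup>2)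
         = (real p)\<^sup>2 * real (card {(i, j) \<in> I \<times> I. [X i = X j] (mod int p) \<and> [Y i = Y j] (mod int p)})"
proof -
  let ?R = "{0..<int p}"
  let ?J = "I \<times> I"
  let ?W = "{(i, j) \<in> I \<times> I. [X i = X j] (mod int p) \<and> [Y i = Y j] (mod int p)}"
  let ?f = "\<lambda>r i j. additive_char p (r * (X i - X j))"
  let ?g = "\<lambda>s i j. additive_char p (s * (Y i - Y j))"
  have square: "complex_of_real ((norm (\<Sum>i\<in>I. additive_char p (r * X i + s * Y i)))\<^sup>2)
      = (\<Sum>(i, j)\<in>?J. ?f r i j * ?g s i j)" for r s
    unfolding complex_norm_square cnj_sum sum_product sum.cartesian_product
    by (intro sum.cong refl)
      (auto simp: cnj_additive_char additive_char_add[symmetric] algebra_simps)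
  have "complex_of_real (\<Sum>r\<in>?R. \<Sum>s\<in>?R. (norm (\<Sum>i\<in>I. additive_char p (r * X i + s * Y i)))\<^sup>2)
      = (\<Sum>r\<in>?R. \<Sum>s\<in>?R. \<Sum>(i, j)\<in>?J. ?f r i j * ?g s i j)"
    unfolding of_real_sum square ..
  also have "\<dots> = (\<Sum>r\<in>?R. \<Sum>P\<in>?J. \<Sum>s\<in>?R. ?f r (fst P) (snd P) * ?g s (fst P) (snd P))"
    by (intro sum.cong refl, subst sum.swap) (simp add: case_prod_beta)
  also have "\<dots> = (\<Sum>P\<in>?J. (\<Sum>r\<in>?R. ?f r (fst P) (snd P)) * (\<Sum>s\<in>?R. ?g s (fst P) (snd P)))"
    by (subst sum.swap) (simp add: sum_product)
  also have "\<dots> = (\<Sum>P\<in>?J. if P \<in> ?W then (of_nat p)\<^sup>2 else 0)"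
    using assms(1)
    by (intro sum.cong refl)
      (auto simp: sum_additive_char cong_iff_dvd_diff power2_eq_square)
  also have "\<dots> = (\<Sum>P\<in>?W. (of_nat p)\<^sup>2)"
    using assms(2) by (intro sum.mono_neutral_cong_right) auto
  also have "\<dots> = complex_of_real ((real p)\<^sup>2 * real (card ?W))"
    by simp
  finally show ?thesis by (simp only: of_real_eq_iff)
qed

text \<open>For p prime and z prime to p, summing over points (x, y) lets y stand for z times the
  inverse of x modulo p; z = 1 gives the classical Kloosterman sum.\<close>

definition kloosterman_sum :: "nat \<Rightarrow> int \<Rightarrow> int \<Rightarrow> int \<Rightarrow> complex" where
  "kloosterman_sum p z r s = (\<Sum>(x, y)\<in>modular_hyperbola p z. additive_char p (r * x + s * y))"

section \<open>Scaling symmetry of Kloosterman sums\<close>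

lemma kloosterman_sum_cong:
  assumes "p > 0" "[r = r'] (mod int p)" "[s = s'] (mod int p)"
  shows "kloosterman_sum p z r s = kloosterman_sum p z r' s'"
  unfolding kloosterman_sum_def
  using assms by (intro sum.cong refl) (auto intro!: additive_char_cong cong_add cong_mult)

lemma modular_hyperbola_scale:
  assumes "prime p" "coprime z (int p)" "(t, t') \<in> modular_hyperbola p 1" "(x, y) \<in> modular_hyperbola p z"
  shows "((t * x) mod int p, (t' * y) mod int p) \<in> modular_hyperbola p z"
proof -
  have c: "[t * t' = 1] (mod int p)" "[x * y = z] (mod int p)"
    using assms(3,4) by (auto simp: modular_hyperbola_def)
  have "[(t * x) mod int p * ((t' * y) mod int p) = (t * x) * (t' * y)] (mod int p)"
    by (intro cong_mult) auto
  also have "(t * x) * (t' * y) = (t * t') * (x * y)" by simp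
  also have "[(t * t') * (x * y) = 1 * z] (mod int p)"
    by (intro cong_mult c)
  finally have c': "[(t * x) mod int p * ((t' * y) mod int p) = z] (mod int p)" by simp
  have nd: "\<not> int p dvd v" if "1 \<le> v" "v < int p" for v
    using that zdvd_imp_le[of "int p" v] by linarith
  have "1 \<le> (u * v) mod int p \<and> (u * v) mod int p < int p"
    if "1 \<le> u" "u < int p" "1 \<le> v" "v < int p" for u v
  proof -
    have "\<not> int p dvd u * v"
      using nd[of u] nd[of v] that assms(1) by (simp add: prime_dvd_mult_iff)
    then have "(u * v) mod int p \<noteq> 0"
      by (simp add: dvd_eq_mod_eq_0)
    moreover have "0 \<le> (u * v) mod int p" "(u * v) mod int p < int p"
      using that by auto
    ultimately show ?thesis by linarith
  qed
  then show ?thesis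
    using assms(3,4) c' by (auto simp: modular_hyperbola_def)
qed

lemma mod_mult_mod_inverse:
  assumes "[t' * t = 1] (mod int p)" "1 \<le> x" "x < int p"
  shows "(t' * ((t * x) mod int p)) mod int p = x"
proof -
  have "[t' * ((t * x) mod int p) = t' * (t * x)] (mod int p)"
    by (intro cong_mult) auto
  also have "t' * (t * x) = (t' * t) * x" by simp
  also have "[(t' * t) * x = 1 * x] (mod int p)"
    using assms by (intro cong_mult) auto
  finally show ?thesis
    using assms by (simp add: cong_def)
qed

text \<open>A point (t, t') with t t' = 1 modulo p acts on the hyperbola by (x, y) -> (t x, t' y),
  preserving x y. This is a permutation, undone by (t', t), so the substitution only reorders the
  sum.\<close>

lemma kloosterman_sum_scale:
  assumes "prime p" "coprime z (int p)" "(t, t') \<in> modular_hyperbola p 1"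
  shows "kloosterman_sum p z (r * t) (s * t') = kloosterman_sum p z r s"
proof -
  have t: "(t', t) \<in> modular_hyperbola p 1" "[t * t' = 1] (mod int p)" "[t' * t = 1] (mod int p)"
    using assms(3) by (auto simp: modular_hyperbola_def mult.commute)
  have p: "p > 0" using assms(1) prime_gt_0_nat by blast
  show ?thesis
    unfolding kloosterman_sum_def
  proof (rule sum.reindex_bij_witness
      [of _ "\<lambda>(x, y). ((t' * x) mod int p, (t * y) mod int p)"
            "\<lambda>(x, y). ((t * x) mod int p, (t' * y) mod int p)"], goal_cases)
    case (1 P)
    then show ?case
      using mod_mult_mod_inverse[OF t(2)] mod_mult_mod_inverse[OF t(3)]
      by (auto simp: modular_hyperbola_def)
  next
    case (2 P)
    then show ?case
      using modular_hyperbola_scale[OF assms] by (cases P) simp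
  next
    case (3 P)
    then show ?case
      using mod_mult_mod_inverse[OF t(2)] mod_mult_mod_inverse[OF t(3)]
      by (auto simp: modular_hyperbola_def)
  next
    case (4 P)
    then show ?case
      using modular_hyperbola_scale[OF assms(1,2) t(1)] by (cases P) simp
  next
    case (5 P)
    have "[r * ((t * fst P) mod int p) + s * ((t' * snd P) mod int p)
         = r * (t * fst P) + s * (t' * snd P)] (mod int p)"
      by (intro cong_add cong_mult) auto
    then show ?case
      using additive_char_cong[OF p] by (auto simp: case_prod_beta mult.assoc)
  qed
qed

text \<open>Modulo p, \<open>x1 * x2 * (y1 + y2)\<close> equals \<open>z * (x1 + x2)\<close>, which
  is nonzero. Equal sums of the x's and of the y's therefore force \<open>x1 * x2\<close> and
  \<open>x3 * x4\<close> to agree, so x1 is a root of the quadratic with roots x3 and x4.\<close>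

lemma sum_product_determines_pair:
  fixes x1 x2 x3 x4 y1 y2 y3 y4 z p :: int
  assumes "prime p" "\<not> p dvd z" "\<not> p dvd x1 + x2"
    and "[x1 * y1 = z] (mod p)" "[x2 * y2 = z] (mod p)" "[x3 * y3 = z] (mod p)" "[x4 * y4 = z] (mod p)"
    and "[x1 + x2 = x3 + x4] (mod p)" "[y1 + y2 = y3 + y4] (mod p)"
  shows "[x1 = x3] (mod p) \<or> [x1 = x4] (mod p)"
proof -
  \<comment> \<open>The congruences become integer equations with explicit multiples of p, so that
    the manipulations below are polynomial identities.\<close>
  obtain k1 k2 k3 k4 k5 k6 where k:
    "x1 * y1 = z + p * k1" "x2 * y2 = z + p * k2" "x3 * y3 = z + p * k3" "x4 * y4 = z + p * k4"
    "x1 + x2 = x3 + x4 + p * k5" "y1 + y2 = y3 + y4 + p * k6"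
    using assms(4-9) by (metis cong_iff_lin cong_sym)
  have "x1 * x2 * (y1 + y2) = x2 * (x1 * y1) + x1 * (x2 * y2)" by (simp add: algebra_simps)
  then have T12: "x1 * x2 * (y1 + y2) = z * (x1 + x2) + p * (x2 * k1 + x1 * k2)"
    unfolding k(1,2) by (simp add: algebra_simps)
  then have "\<not> p dvd x1 * x2 * (y1 + y2)"
    using assms(1,2,3) by (simp add: dvd_add_left_iff prime_dvd_mult_iff)
  then have T: "\<not> p dvd y1 + y2" by auto
  have "x3 * x4 * (y3 + y4) = x4 * (x3 * y3) + x3 * (x4 * y4)" by (simp add: algebra_simps)
  then have T34: "x3 * x4 * (y3 + y4) = z * (x3 + x4) + p * (x4 * k3 + x3 * k4)"
    unfolding k(3,4) by (simp add: algebra_simps)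
  have "(x1 * x2 - x3 * x4) * (y1 + y2) = x1 * x2 * (y1 + y2) - x3 * x4 * (y3 + y4) - p * (x3 * x4 * k6)"
    unfolding k(6) by (simp add: algebra_simps)
  also have "\<dots> = p * (z * k5 + x2 * k1 + x1 * k2 - x4 * k3 - x3 * k4 - x3 * x4 * k6)"
    unfolding T12 T34 k(5) by (simp add: algebra_simps)
  finally have "(x1 * x2 - x3 * x4) * (y1 + y2) =
    p * (z * k5 + x2 * k1 + x1 * k2 - x4 * k3 - x3 * k4 - x3 * x4 * k6)" .
  then have "p dvd x1 * x2 - x3 * x4"
    using T assms(1) by (metis dvd_triv_left prime_dvd_mult_iff)
  then obtain k7 where "x1 * x2 - x3 * x4 = p * k7" by (auto simp: dvd_def)
  then have *: "x3 * x4 = x1 * x2 - p * k7" "x3 + x4 = x1 + x2 - p * k5"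
    using k(5) by simp_all
  \<comment> \<open>This evaluates the quadratic with roots x3 and x4 at x1.\<close>
  have "(x1 - x3) * (x1 - x4) = x1 * x1 - x1 * (x3 + x4) + x3 * x4"
    by (simp add: algebra_simps)
  also have "\<dots> = p * (x1 * k5 - k7)"
    unfolding * by (simp add: algebra_simps)
  finally have "(x1 - x3) * (x1 - x4) = p * (x1 * k5 - k7)" .
  then have "p dvd x1 - x3 \<or> p dvd x1 - x4"
    using assms(1) by (metis dvd_triv_left prime_dvd_mult_iff)
  then show ?thesis by (simp add: cong_iff_dvd_diff)
qed

text \<open>Two pairs with the same coordinate sums are equal (\<open>?D2\<close>), swapped
  (\<open>?D3\<close>), or each made of antipodal points (\<open>?D1\<close>). Each family has two
  free points, hence at most (p - 1)^2 members.\<close>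

lemma modular_hyperbola_energy_le:
  assumes "prime p" "coprime z (int p)"
  defines "H \<equiv> modular_hyperbola p z"
  shows "card {((P1, P2), (P3, P4)) \<in> (H \<times> H) \<times> (H \<times> H).
           [fst P1 + fst P2 = fst P3 + fst P4] (mod int p) \<and>
           [snd P1 + snd P2 = snd P3 + snd P4] (mod int p)} \<le> 3 * (p - 1)\<^sup>2"
    (is "card ?W \<le> _")
proof -
  let ?n = "\<lambda>P. (int p - fst P, int p - snd P)"
  let ?D1 = "(\<lambda>(P, Q). ((P, ?n P), (Q, ?n Q))) ` (H \<times> H)"
  let ?D2 = "(\<lambda>(P, Q). ((P, Q), (P, Q))) ` (H \<times> H)"
  let ?D3 = "(\<lambda>(P, Q). ((P, Q), (Q, P))) ` (H \<times> H)"
  have p: "prime (int p)" using assms(1) by simp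
  have z: "\<not> int p dvd z"
    using assms(1,2) by (metis coprime_commute coprime_absorb_left not_prime_unit prime_nat_int_transfer)
  have inj: "P = Q" if "P \<in> H" "Q \<in> H" "[fst P = fst Q] (mod int p)" for P Q
  proof -
    have "fst P = fst Q"
      using that by (auto simp: H_def modular_hyperbola_def cong_def)
    then show ?thesis
      using that bij_betw_fst_modular_hyperbola[OF assms(1,2)]
      by (auto simp: H_def bij_betw_def dest: inj_onD)
  qed
  \<comment> \<open>A vanishing sum of abscissae forces the second point to be the reflection
    \<open>?n P\<close>, which also lies on the hyperbola and has the right abscissa modulo
    p.\<close>
  have antipode: "Q = ?n P" if "P \<in> H" "Q \<in> H" "int p dvd fst P + fst Q" for P Q
  proof -
    have neg: "?n P \<in> H"
    proof -
      have "[(int p - fst P) * (int p - snd P) = (- fst P) * (- snd P)] (mod int p)"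
        by (intro cong_mult) (auto simp: cong_iff_dvd_diff)
      then show ?thesis
        using that(1) by (auto simp: H_def modular_hyperbola_def cong_def)
    qed
    have "[fst Q = fst (?n P)] (mod int p)"
    proof -
      have "fst Q - fst (?n P) = (fst P + fst Q) - int p" by simp
      then show ?thesis
        using that(3) by (metis cong_iff_dvd_diff dvd_diff dvd_refl)
    qed
    then show ?thesis using inj[OF that(2) neg] by simp
  qed
  have "?W \<subseteq> ?D1 \<union> ?D2 \<union> ?D3"
  proof
    fix w assume "w \<in> ?W"
    then obtain P1 P2 P3 P4 where w: "w = ((P1, P2), (P3, P4))"
      and P: "P1 \<in> H" "P2 \<in> H" "P3 \<in> H" "P4 \<in> H"
      and c: "[fst P1 + fst P2 = fst P3 + fst P4] (mod int p)"
             "[snd P1 + snd P2 = snd P3 + snd P4] (mod int p)"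
      by auto
    have m: "[fst P * snd P = z] (mod int p)" if "P \<in> H" for P
      using that by (auto simp: H_def modular_hyperbola_def)
    show "w \<in> ?D1 \<union> ?D2 \<union> ?D3"
    proof (cases "int p dvd fst P1 + fst P2")
      case True
      then have "int p dvd fst P3 + fst P4"
        using c(1) cong_dvd_iff by blast
      then have "w = (\<lambda>(P, Q). ((P, ?n P), (Q, ?n Q))) (P1, P3)"
        using antipode[OF P(1,2) True] antipode[OF P(3,4)] w by simp
      then have "w \<in> ?D1" using P by blast
      then show ?thesis by blast
    next
      case False
      from sum_product_determines_pair[OF p z False m[OF P(1)] m[OF P(2)] m[OF P(3)] m[OF P(4)] c]
      show ?thesis
      proof
        assume e: "[fst P1 = fst P3] (mod int p)"
        then have "P1 = P3" using inj P by blast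
        then have "P2 = P4" using inj P c(1) by (auto simp: cong_add_lcancel)
        then have "w = (\<lambda>(P, Q). ((P, Q), (P, Q))) (P1, P2)" using \<open>P1 = P3\<close> w by simp
        then have "w \<in> ?D2" using P by blast
        then show ?thesis by blast
      next
        assume e: "[fst P1 = fst P4] (mod int p)"
        then have "P1 = P4" using inj P by blast
        then have "[fst P1 + fst P2 = fst P1 + fst P3] (mod int p)"
          using c(1) by (simp add: add.commute)
        then have "P2 = P3" using inj P by (auto simp: cong_add_lcancel)
        then have "w = (\<lambda>(P, Q). ((P, Q), (Q, P))) (P1, P2)" using \<open>P1 = P4\<close> w by simp
        then have "w \<in> ?D3" using P by blast
        then show ?thesis by blast
      qed
    qed
  qed
  moreover have fin: "finite (H \<times> H)" by (simp add: H_def)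
  ultimately have "card ?W \<le> card (?D1 \<union> ?D2 \<union> ?D3)"
    by (intro card_mono) auto
  also have "\<dots> \<le> card ?D1 + card ?D2 + card ?D3"
    by (meson add_le_mono1 card_Un_le order_trans)
  also have "\<dots> \<le> card (H \<times> H) + card (H \<times> H) + card (H \<times> H)"
    by (intro add_mono card_image_le fin)
  also have "\<dots> = 3 * (p - 1)\<^sup>2"
    using card_modular_hyperbola[OF assms(1,2)] by (simp add: H_def power2_eq_square)
  finally show ?thesis .
qed

section \<open>The fourth moment of Kloosterman sums and the resulting pointwise bound\<close>

lemma sum_norm_kloosterman_sum_power4_le:
  assumes "prime p" "coprime z (int p)"
  shows "(\<Sum>r\<in>{0..<int p}. \<Sum>s\<in>{0..<int p}. norm (kloosterman_sum p z r s) ^ 4)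
         \<le> 3 * (real p)\<^sup>2 * (real p - 1)\<^sup>2"
proof -
  let ?H = "modular_hyperbola p z"
  let ?X = "\<lambda>(P, Q). fst P + fst Q" and ?Y = "\<lambda>(P, Q). snd P + snd Q"
  have p: "p > 0" using assms(1) prime_gt_0_nat by blast
  \<comment> \<open>The squared sum runs over pairs of points with added coordinates, so the fourth
    moment is p^2 times the number of coincidences bounded in
    \<open>modular_hyperbola_energy_le\<close>.\<close>
  have "kloosterman_sum p z r s ^ 2 = (\<Sum>i\<in>?H \<times> ?H. additive_char p (r * ?X i + s * ?Y i))" for r s
    unfolding kloosterman_sum_def power2_eq_square sum_product sum.cartesian_product
    by (intro sum.cong refl) (auto simp: additive_char_add[symmetric] algebra_simps)
  then have "norm (kloosterman_sum p z r s) ^ 4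
      = (norm (\<Sum>i\<in>?H \<times> ?H. additive_char p (r * ?X i + s * ?Y i)))\<^sup>2" for r s
    by (metis norm_power numeral_Bit0 power2_eq_square power_add)
  then have "(\<Sum>r\<in>{0..<int p}. \<Sum>s\<in>{0..<int p}. norm (kloosterman_sum p z r s) ^ 4)
     = (real p)\<^sup>2 * real (card {(i, j) \<in> (?H \<times> ?H) \<times> (?H \<times> ?H).
           [?X i = ?X j] (mod int p) \<and> [?Y i = ?Y j] (mod int p)})"
    by (simp only: sum_norm_square_additive_char_2[OF p] finite_cartesian_product finite_modular_hyperbola)
  also have "{(i, j) \<in> (?H \<times> ?H) \<times> (?H \<times> ?H). [?X i = ?X j] (mod int p) \<and> [?Y i = ?Y j] (mod int p)}
     = {((P1, P2), (P3, P4)) \<in> (?H \<times> ?H) \<times> (?H \<times> ?H).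
           [fst P1 + fst P2 = fst P3 + fst P4] (mod int p) \<and>
           [snd P1 + snd P2 = snd P3 + snd P4] (mod int p)}"
    by auto
  also have "(real p)\<^sup>2 * real (card \<dots>) \<le> (real p)\<^sup>2 * real (3 * (p - 1)\<^sup>2)"
    using modular_hyperbola_energy_le[OF assms] by (intro mult_left_mono of_nat_mono) auto
  also have "\<dots> = 3 * (real p)\<^sup>2 * (real p - 1)\<^sup>2"
    using p by (simp add: of_nat_diff)
  finally show ?thesis .
qed

text \<open>The scaling symmetry makes \<open>p - 1\<close> pairs \<open>(r, s)\<close> contribute equally to the fourth moment.\<close>

lemma norm_kloosterman_sum_power4_le:
  assumes "prime p" "coprime z (int p)" "\<not> int p dvd s"
  shows "norm (kloosterman_sum p z r s) ^ 4 \<le> 3 * real p ^ 3"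
proof -
  let ?H = "modular_hyperbola p 1"
  let ?R = "{0..<int p}"
  let ?g = "\<lambda>(t, t'). ((r * t) mod int p, (s * t') mod int p)"
  let ?K = "\<lambda>(r, s). norm (kloosterman_sum p z r s) ^ 4"
  have p: "p > 0" using assms(1) prime_gt_0_nat by blast
  have p1: "real p > 1" using assms(1) prime_gt_1_nat by simp
  \<comment> \<open>Since p does not divide s, the residue of \<open>s * t'\<close> determines t'
    and hence the point, so the p - 1 scaled pairs are distinct.\<close>
  have inj: "inj_on ?g ?H"
  proof (rule inj_onI)
    fix P Q assume PQ: "P \<in> ?H" "Q \<in> ?H" "?g P = ?g Q"
    then have "[s * snd P = s * snd Q] (mod int p)"
      by (auto simp: case_prod_beta cong_def)
    then have "[snd P = snd Q] (mod int p)"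
      using prime_cong_mult_cancel[OF assms(1,3)] by blast
    then have "snd P = snd Q"
      using PQ by (auto simp: modular_hyperbola_def cong_def)
    then show "P = Q"
      using PQ(1,2) bij_betw_snd_modular_hyperbola[OF assms(1), of 1]
      by (auto simp: bij_betw_def dest: inj_onD)
  qed
  have "(real p - 1) * norm (kloosterman_sum p z r s) ^ 4 = (\<Sum>P\<in>?H. norm (kloosterman_sum p z r s) ^ 4)"
    using card_modular_hyperbola[OF assms(1), of 1] p by (simp add: of_nat_diff)
  also have "\<dots> = (\<Sum>P\<in>?H. ?K (?g P))"
  proof (intro sum.cong refl)
    fix P assume "P \<in> ?H"
    then have "kloosterman_sum p z (r * fst P) (s * snd P) = kloosterman_sum p z r s"
      using kloosterman_sum_scale[OF assms(1,2)] by (cases P) auto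
    moreover have "kloosterman_sum p z ((r * fst P) mod int p) ((s * snd P) mod int p)
        = kloosterman_sum p z (r * fst P) (s * snd P)"
      by (intro kloosterman_sum_cong p) auto
    ultimately show "norm (kloosterman_sum p z r s) ^ 4 = ?K (?g P)"
      by (simp add: case_prod_beta)
  qed
  also have "\<dots> = (\<Sum>Q\<in>?g ` ?H. ?K Q)"
    using inj by (simp add: sum.reindex)
  also have "\<dots> \<le> (\<Sum>Q\<in>?R \<times> ?R. ?K Q)"
    using p by (intro sum_mono2) auto
  also have "\<dots> \<le> 3 * (real p)\<^sup>2 * (real p - 1)\<^sup>2"
    using sum_norm_kloosterman_sum_power4_le[OF assms(1,2)] by (simp add: sum.cartesian_product)
  also have "\<dots> = (real p - 1) * (3 * (real p)\<^sup>2 * (real p - 1))"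
    by (simp add: power2_eq_square)
  finally have "norm (kloosterman_sum p z r s) ^ 4 \<le> 3 * (real p)\<^sup>2 * (real p - 1)"
    using p1 by simp
  also have "\<dots> \<le> 3 * (real p)\<^sup>2 * real p"
    by (intro mult_left_mono) auto
  finally show ?thesis by (simp add: power2_eq_square power3_eq_cube)
qed

lemma norm_kloosterman_sum_le:
  assumes "prime p" "coprime z (int p)" "\<not> int p dvd s"
  shows "norm (kloosterman_sum p z r s) \<le> 2 * real p powr (3 / 4)"
proof -
  have p: "p > 0" using assms(1) prime_gt_0_nat by blast
  have "(real p powr (3 / 4)) ^ 4 = real p ^ 3"
    using p by (simp add: powr_realpow[symmetric] powr_powr flip: powr_numeral)
  \<comment> \<open>The constant 2 suffices for the fourth root because 3 <= 2^4.\<close>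
  then have "3 * real p ^ 3 \<le> (2 * real p powr (3 / 4)) ^ 4"
    by (simp add: power_mult_distrib)
  with norm_kloosterman_sum_power4_le[OF assms, of r]
  have "norm (kloosterman_sum p z r s) ^ 4 \<le> (2 * real p powr (3 / 4)) ^ 4"
    by linarith
  then show ?thesis by (rule power_le_imp_le_base[of _ 3, simplified]) auto
qed

section \<open>Counting points of the hyperbola with twisted weights\<close>

text \<open>Completion in both variables. Characters detecting the ordinate give the main term at s
  = 0. For other s, characters detecting the abscissa produce Kloosterman sums whose second
  frequency is prime to p, hence bounded uniformly in r, including r = 0. The factors p on the left
  clear the denominators of the two detections.\<close>

lemma weighted_hyperbola_count:
  fixes c :: "'a \<Rightarrow> complex" and X :: "'a \<Rightarrow> int" and Y :: "'b \<Rightarrow> int"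
  assumes "prime p" "coprime z (int p)"
    and X: "\<And>i. i \<in> I \<Longrightarrow> 1 \<le> X i \<and> X i < int p"
    and Y: "\<And>j. j \<in> J \<Longrightarrow> 1 \<le> Y j \<and> Y j < int p"
  shows "real p * norm (of_nat p * (\<Sum>i\<in>I. \<Sum>j\<in>J. c i * of_bool ((X i, Y j) \<in> modular_hyperbola p z))
           - of_nat (card J) * (\<Sum>i\<in>I. c i))
         \<le> 2 * real p powr (3 / 4)
           * (\<Sum>r\<in>{0..<int p}. norm (\<Sum>i\<in>I. c i * additive_char p (r * X i)))
           * (\<Sum>s\<in>{0..<int p}. norm (\<Sum>j\<in>J. additive_char p (s * Y j)))"
proof -
  let ?H = "modular_hyperbola p z"
  let ?R = "{0..<int p}"
  let ?e = "additive_char p"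
  let ?C = "\<lambda>r. \<Sum>i\<in>I. c i * ?e (r * X i)"
  let ?Y = "\<lambda>s. \<Sum>j\<in>J. ?e (s * Y j)"
  let ?S = "\<Sum>i\<in>I. \<Sum>j\<in>J. c i * of_bool ((X i, Y j) \<in> ?H)"
  \<comment> \<open>\<open>G s\<close> has only the ordinate condition expanded into characters; the
    abscissa condition is still exact.\<close>
  define G where "G s = (\<Sum>i\<in>I. c i * (\<Sum>P\<in>?H. of_bool (X i = fst P) * ?e (- (s * snd P))))" for s
  have p: "p > 0" using assms(1) prime_gt_0_nat by blast
  have detect: "of_nat p * of_bool (v = w) = (\<Sum>s\<in>?R. ?e (s * v) * ?e (- (s * w)))"
    if "1 \<le> v \<and> v < int p" "1 \<le> w \<and> w < int p" for v w
  proof -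
    have "v = w \<longleftrightarrow> int p dvd v - w"
      using that by (auto simp: cong_def simp flip: cong_iff_dvd_diff)
    then show ?thesis
      using sum_additive_char[OF p, of "v - w"]
      by (simp add: right_diff_distrib flip: additive_char_add)
  qed
  have range: "1 \<le> fst P \<and> fst P < int p" "1 \<le> snd P \<and> snd P < int p" if "P \<in> ?H" for P
    using that by (auto simp: modular_hyperbola_def)
  have point: "of_bool ((v, w) \<in> ?H) = (\<Sum>P\<in>?H. of_bool (v = fst P) * of_bool (w = snd P) :: complex)" for v w
  proof -
    have "(\<Sum>P\<in>?H. of_bool (v = fst P) * of_bool (w = snd P) :: complex)
        = (\<Sum>P\<in>?H. if (v, w) = P then 1 else 0)"
      by (intro sum.cong refl) auto
    then show ?thesis by simp
  qed
  have "of_nat p * ?S = (\<Sum>i\<in>I. \<Sum>j\<in>J. \<Sum>P\<in>?H. c i * of_bool (X i = fst P) * (of_nat p * of_bool (Y j = snd P)))"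
    unfolding point sum_distrib_left by (intro sum.cong refl) (simp only: mult_ac)
  also have "\<dots> = (\<Sum>i\<in>I. \<Sum>j\<in>J. \<Sum>P\<in>?H. \<Sum>s\<in>?R. c i * of_bool (X i = fst P) * (?e (s * Y j) * ?e (- (s * snd P))))"
    by (intro sum.cong refl, subst detect[OF Y range(2)]) (simp_all add: sum_distrib_left)
  also have "\<dots> = (\<Sum>s\<in>?R. \<Sum>i\<in>I. \<Sum>j\<in>J. \<Sum>P\<in>?H. c i * of_bool (X i = fst P) * (?e (s * Y j) * ?e (- (s * snd P))))"
    by (simp only: sum.swap[of _ ?R])
  also have "\<dots> = (\<Sum>s\<in>?R. ?Y s * G s)"
  proof (intro sum.cong refl)
    fix s
    have "(\<Sum>j\<in>J. \<Sum>P\<in>?H. c i * of_bool (X i = fst P) * (?e (s * Y j) * ?e (- (s * snd P))))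
        = ?Y s * (c i * (\<Sum>P\<in>?H. of_bool (X i = fst P) * ?e (- (s * snd P))))" for i
      unfolding sum_distrib_left[of "c i"] sum_product
      by (intro sum.cong refl) (simp only: mult_ac)
    then show "(\<Sum>i\<in>I. \<Sum>j\<in>J. \<Sum>P\<in>?H. c i * of_bool (X i = fst P) * (?e (s * Y j) * ?e (- (s * snd P)))) = ?Y s * G s"
      by (simp add: G_def sum_distrib_left)
  qed
  also have "\<dots> = ?Y 0 * G 0 + (\<Sum>s\<in>?R - {0}. ?Y s * G s)"
    using p by (subst sum.remove[of _ 0]) auto
  finally have S: "of_nat p * ?S = ?Y 0 * G 0 + (\<Sum>s\<in>?R - {0}. ?Y s * G s)" .

  \<comment> \<open>Each admissible abscissa belongs to exactly one point of the hyperbola, so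
    \<open>G 0\<close> is the plain sum of the weights.\<close>
  have one: "(\<Sum>P\<in>?H. of_bool (X i = fst P) :: complex) = 1" if "i \<in> I" for i
  proof -
    have "(\<Sum>P\<in>?H. of_bool (X i = fst P) :: complex) = (\<Sum>x\<in>{1..<int p}. of_bool (X i = x))"
      by (rule sum.reindex_bij_betw[OF bij_betw_fst_modular_hyperbola[OF assms(1,2)]])
    then show ?thesis using X[OF that] by (simp add: of_bool_def)
  qed
  have "G 0 = (\<Sum>i\<in>I. c i * (\<Sum>P\<in>?H. of_bool (X i = fst P)))"
    unfolding G_def by (simp only: mult_zero_left minus_zero additive_char_0 mult_1_right)
  also have "\<dots> = (\<Sum>i\<in>I. c i)"
    by (intro sum.cong refl) (simp only: one mult_1_right)
  finally have G0: "?Y 0 * G 0 = of_nat (card J) * (\<Sum>i\<in>I. c i)"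
    by simp

  \<comment> \<open>For nonzero s the abscissa condition is expanded as well.\<close>
  have G: "real p * norm (G s) \<le> 2 * real p powr (3 / 4) * (\<Sum>r\<in>?R. norm (?C r))" if "s \<in> ?R - {0}" for s
  proof -
    have s: "\<not> int p dvd - s"
      using that zdvd_imp_le[of "int p" s] by auto
    have "of_nat p * G s = (\<Sum>i\<in>I. \<Sum>P\<in>?H. c i * ?e (- (s * snd P)) * (of_nat p * of_bool (X i = fst P)))"
      unfolding G_def sum_distrib_left by (intro sum.cong refl) (simp only: mult_ac)
    also have "\<dots> = (\<Sum>i\<in>I. \<Sum>P\<in>?H. \<Sum>r\<in>?R. c i * ?e (- (s * snd P)) * (?e (r * X i) * ?e (- (r * fst P))))"
      by (intro sum.cong refl, subst detect[OF X range(1)]) (simp_all add: sum_distrib_left)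
    also have "\<dots> = (\<Sum>r\<in>?R. \<Sum>i\<in>I. \<Sum>P\<in>?H. c i * ?e (- (s * snd P)) * (?e (r * X i) * ?e (- (r * fst P))))"
      by (simp only: sum.swap[of _ ?R])
    also have "\<dots> = (\<Sum>r\<in>?R. ?C r * kloosterman_sum p z (- r) (- s))"
      unfolding kloosterman_sum_def case_prod_beta sum_product additive_char_add
      by (intro sum.cong refl) (simp add: mult_ac)
    finally have "real p * norm (G s) = norm (\<Sum>r\<in>?R. ?C r * kloosterman_sum p z (- r) (- s))"
      by (metis norm_mult norm_of_nat)
    also have "\<dots> \<le> (\<Sum>r\<in>?R. norm (?C r) * (2 * real p powr (3 / 4)))"
      by (intro sum_norm_le) (auto simp: norm_mult intro!: mult_left_mono norm_kloosterman_sum_le[OF assms(1,2) s])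
    finally show ?thesis
      unfolding sum_distrib_right[symmetric] by (simp only: mult_ac)
  qed
  have "real p * norm (of_nat p * ?S - of_nat (card J) * (\<Sum>i\<in>I. c i))
      = real p * norm (\<Sum>s\<in>?R - {0}. ?Y s * G s)"
    unfolding S G0 by simp
  also have "\<dots> \<le> real p * (\<Sum>s\<in>?R - {0}. norm (?Y s) * norm (G s))"
    by (intro mult_left_mono sum_norm_le) (auto simp: norm_mult)
  also have "\<dots> = (\<Sum>s\<in>?R - {0}. norm (?Y s) * (real p * norm (G s)))"
    by (simp add: sum_distrib_left mult_ac)
  also have "\<dots> \<le> (\<Sum>s\<in>?R - {0}. norm (?Y s) * (2 * real p powr (3 / 4) * (\<Sum>r\<in>?R. norm (?C r))))"
    by (intro sum_mono mult_left_mono G) auto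
  \<comment> \<open>The nonnegative term s = 0 is put back, leaving a complete sum to which Parseval
    can be applied.\<close>
  also have "\<dots> \<le> (\<Sum>s\<in>?R. norm (?Y s) * (2 * real p powr (3 / 4) * (\<Sum>r\<in>?R. norm (?C r))))"
    by (intro sum_mono2) (auto intro!: mult_nonneg_nonneg sum_nonneg)
  also have "\<dots> = 2 * real p powr (3 / 4) * (\<Sum>r\<in>?R. norm (?C r)) * (\<Sum>s\<in>?R. norm (?Y s))"
    unfolding sum_distrib_right[symmetric] by (simp only: mult_ac)
  finally show ?thesis .
qed

text \<open>The double sum factors: up to a phase it is the square of a sum over an interval. Its
  absolute values therefore add up to a squared L2 norm, which Parseval evaluates without a
  logarithm; \<open>M \<le> p\<close> makes the residues distinct.\<close>

lemma sum_norm_additive_char_sumset: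
  fixes u :: complex and x :: int
  assumes "p > 0" "norm u = 1" "M \<le> p"
  shows "(\<Sum>r\<in>{0..<int p}. norm (\<Sum>(a, b)\<in>{..<M} \<times> {..<M}. u ^ (a + b) * additive_char p (r * (x + int a + int b))))
         = real p * real M"
proof -
  have "(\<Sum>(a, b)\<in>{..<M} \<times> {..<M}. u ^ (a + b) * additive_char p (r * (x + int a + int b)))
      = additive_char p (r * x) * (\<Sum>a<M. u ^ a * additive_char p (r * int a))\<^sup>2" for r
    by (simp add: power2_eq_square sum_product sum.cartesian_product[symmetric] sum_distrib_left
        distrib_left additive_char_add power_add mult_ac)
  then have "norm (\<Sum>(a, b)\<in>{..<M} \<times> {..<M}. u ^ (a + b) * additive_char p (r * (x + int a + int b)))
      = (norm (\<Sum>a<M. u ^ a * additive_char p (r * int a)))\<^sup>2" for r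
    by (simp add: norm_mult norm_power)
  then show ?thesis
    using assms parseval_additive_char[of p "{..<M}" int "\<lambda>a. u ^ a"]
    by (simp add: cong_def norm_power)
qed

text \<open>Completion costs p M in each coordinate by \<open>sum_norm_additive_char_sumset\<close>,
  only the abscissa carrying the twist u. As a + b and c + d are at most 2 M - 2, the size
  conditions keep both coordinates in [1, p).\<close>

lemma twisted_hyperbola_count:
  fixes u :: complex and x :: int
  assumes "prime p" "coprime z (int p)" "norm u = 1"
    and "1 \<le> x" "x + 2 * int M \<le> int p + 1" "2 * M \<le> p"
  shows "norm (of_nat p * (\<Sum>(a, b)\<in>{..<M} \<times> {..<M}. \<Sum>(c, d)\<in>{..<M} \<times> {..<M}.
             u ^ (a + b) * of_bool ((x + int a + int b, 1 + int c + int d) \<in> modular_hyperbola p z))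
           - (of_nat M)\<^sup>2 * (\<Sum>a<M. u ^ a)\<^sup>2)
         \<le> 2 * real p powr (3 / 4) * (real p * (real M)\<^sup>2)"
proof -
  let ?B = "{..<M} \<times> {..<M}"
  have p: "p > 0" using assms(1) prime_gt_0_nat by blast
  have square: "(\<Sum>P\<in>?B. u ^ (fst P + snd P)) = (\<Sum>a<M. u ^ a)\<^sup>2"
    by (simp add: power2_eq_square sum_product sum.cartesian_product case_prod_beta power_add)
  have "real p * norm (of_nat p * (\<Sum>P\<in>?B. \<Sum>Q\<in>?B.
             u ^ (fst P + snd P) * of_bool ((x + int (fst P) + int (snd P), 1 + int (fst Q) + int (snd Q)) \<in> modular_hyperbola p z))
           - of_nat (card ?B) * (\<Sum>P\<in>?B. u ^ (fst P + snd P)))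
     \<le> 2 * real p powr (3 / 4) * (real p * real M) * (real p * real M)"
    using weighted_hyperbola_count[OF assms(1,2), of ?B "\<lambda>P. x + int (fst P) + int (snd P)" ?B
        "\<lambda>Q. 1 + int (fst Q) + int (snd Q)" "\<lambda>P. u ^ (fst P + snd P)"] assms(4-6)
      sum_norm_additive_char_sumset[OF p assms(3), of M x]
      sum_norm_additive_char_sumset[OF p norm_one, of M 1]
    by (auto simp: case_prod_beta)
  also have "\<dots> = real p * (2 * real p powr (3 / 4) * (real p * (real M)\<^sup>2))"
    by (simp add: power2_eq_square)
  finally show ?thesis
    using p square by (simp add: case_prod_beta power2_eq_square)
qed

lemma norm_geometric_sum_le:
  fixes u :: complex
  assumes "norm u = 1" "u \<noteq> 1"
  shows "norm (\<Sum>a<M. u ^ a) \<le> 2 / norm (1 - u)"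
proof -
  have "norm (1 - u ^ M) \<le> 2"
    using norm_triangle_ineq4[of 1 "u ^ M"] assms(1) by (simp add: norm_power)
  then show ?thesis
    using assms(2) by (simp add: sum_gp_strict norm_divide divide_right_mono)
qed

section \<open>Points with abscissa in a Beatty set\<close>

text \<open>Binomial theorem for the 2k-th power of (e^(it) + e^(-it)) / 2; the constant term sits
  at j = k.\<close>

lemma cos_power_even_expansion:
  "complex_of_real (cos t ^ (2 * k))
     = (\<Sum>j\<le>2 * k. of_real (real (2 * k choose j) / 4 ^ k) * cis (2 * (real k - real j) * t))"
proof -
  have "complex_of_real (cos t) = (cis (- t) + cis t) / 2"
    by (simp add: complex_eq_iff)
  then have "complex_of_real (cos t ^ (2 * k)) = ((cis (- t) + cis t) / 2) ^ (2 * k)"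
    by (simp only: of_real_power)
  also have "\<dots> = (cis (- t) + cis t) ^ (2 * k) / 4 ^ k"
    by (simp add: power_divide power_mult)
  also have "\<dots> = (\<Sum>j\<le>2 * k. of_nat (2 * k choose j) * cis (- t) ^ j * cis t ^ (2 * k - j)) / 4 ^ k"
    by (simp add: binomial_ring)
  also have "\<dots> = (\<Sum>j\<le>2 * k. of_real (real (2 * k choose j) / 4 ^ k) * cis (2 * (real k - real j) * t))"
    unfolding sum_divide_distrib
    by (intro sum.cong refl) (simp add: Complex.DeMoivre cis_mult of_nat_diff algebra_simps)
  finally show ?thesis .
qed

text \<open>Membership means that some n \<ge> 1 has n \<alpha> in [x - \<beta>, x - \<beta> + 1),
  an interval centred at x - \<beta> + 1/2. So t = (x - \<beta> + 1/2) / \<alpha> should lie within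
  1 / (2 \<alpha>) of an integer, and cos^2(\<pi> t) decreases with the distance from t to the
  nearest integer.\<close>

lemma mem_beatty_set_if_cos_gt:
  fixes \<alpha> \<beta> :: real and x :: int
  assumes "\<alpha> > 1" "\<beta> < real_of_int x"
    and "cos (pi * ((real_of_int x - \<beta> + 1 / 2) / \<alpha>)) ^ 2 > cos (pi / (2 * \<alpha>)) ^ 2"
  shows "x \<in> beatty_set \<alpha> \<beta>"
proof -
  define t where "t = (real_of_int x - \<beta> + 1 / 2) / \<alpha>"
  define n where "n = round t"
  define d where "d = \<bar>t - real_of_int n\<bar>"
  have d: "0 \<le> d" "d \<le> 1 / 2"
    unfolding d_def n_def using of_int_round_abs_le[of t] by (auto simp: abs_minus_commute)
  have "cos (pi * d) = cos (pi * t - pi * real_of_int n)"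
    unfolding d_def by (cases "t \<ge> real_of_int n") (simp_all add: algebra_simps abs_if cos_diff)
  \<comment> \<open>Shifting t by an integer changes the cosine at most by a sign, which the square
    removes.\<close>
  also have "\<dots> ^ 2 = cos (pi * t) ^ 2"
    by (simp add: cos_diff power_mult_distrib)
  finally have gt: "cos (pi * d) ^ 2 > cos (pi / (2 * \<alpha>)) ^ 2"
    using assms(3) by (simp add: t_def)
  have "d < 1 / (2 * \<alpha>)"
  proof (rule ccontr)
    assume "\<not> d < 1 / (2 * \<alpha>)"
    then have le: "pi * (1 / (2 * \<alpha>)) \<le> pi * d"
      by (intro mult_left_mono) auto
    have half: "pi * d \<le> pi / 2" using d(2) by simp
    have "cos (pi * d) \<le> cos (pi * (1 / (2 * \<alpha>)))"
      using le half assms(1) by (intro cos_monotone_0_pi_le) auto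
    then have "cos (pi * d) ^ 2 \<le> cos (pi * (1 / (2 * \<alpha>))) ^ 2"
    proof (rule power_mono)
      show "0 \<le> cos (pi * d)"
      using d half by (intro cos_ge_zero) (auto intro: order_trans[of _ 0])
    qed
    then show False using gt by simp
  qed
  then have "\<alpha> * \<bar>t - real_of_int n\<bar> < 1 / 2"
    using assms(1) by (simp add: d_def field_simps)
  then have "\<bar>\<alpha> * t - \<alpha> * real_of_int n\<bar> < 1 / 2"
    using assms(1) by (simp add: abs_mult flip: right_diff_distrib)
  moreover have "\<alpha> * t = real_of_int x - \<beta> + 1 / 2"
    using assms(1) by (simp add: t_def)
  ultimately have n: "real_of_int x - \<beta> < \<alpha> * real_of_int n" "\<alpha> * real_of_int n < real_of_int x - \<beta> + 1"
    by linarith+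
  \<comment> \<open>Beatty indices start at 1, so n has to be positive; \<beta> < x guarantees
    this.\<close>
  then have "0 < \<alpha> * real_of_int n" using assms(2) by linarith
  then have pos: "n > 0" using assms(1) by (simp add: zero_less_mult_iff)
  have "\<lfloor>real (nat n) * \<alpha> + \<beta>\<rfloor> = x"
    using n pos by (simp add: floor_eq_iff mult.commute)
  then show ?thesis
    unfolding beatty_set_def using pos by (intro CollectI exI[of _ "nat n"]) auto
qed

text \<open>For k > 0 the right side is at least 1 / (2 k), while the left side decays
  geometrically.\<close>

lemma ex_central_binomial_gt_power:
  fixes \<rho> :: real
  assumes "0 \<le> \<rho>" "\<rho> < 1"
  shows "\<exists>k. \<rho> ^ k < real (2 * k choose k) / 4 ^ k"
proof -
  have "(\<lambda>k. 2 * (real k * \<rho> ^ k)) \<longlonglongrightarrow> 2 * 0"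
    using assms by (intro tendsto_mult_left powser_times_n_limit_0) auto
  then have "eventually (\<lambda>k. 2 * (real k * \<rho> ^ k) < 1) sequentially"
    by (rule order_tendstoD) simp
  then have "eventually (\<lambda>k. 2 * (real k * \<rho> ^ k) < 1 \<and> k > 0) sequentially"
    using eventually_gt_at_top[of 0] by eventually_elim auto
  then obtain k :: nat where k: "2 * (real k * \<rho> ^ k) < 1" "k > 0"
    using eventually_happens'[OF sequentially_bot] by blast
  then have "\<rho> ^ k < 1 / (2 * real k)"
    by (simp add: field_simps)
  also have "\<dots> \<le> real (2 * k choose k) / 4 ^ k"
    using central_binomial_lower_bound[OF k(2)] k(2) by (simp add: field_simps)
  finally show ?thesis by blast
qed

text \<open>The sum \<open>T\<close> weighs the hits by \<open>F\<close>, which is positive only at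
  abscissae in the Beatty set. The constant frequency gives the main term (\<kappa> - \<rho>^k) M^4
  / p, \<open>B\<close> bounds the squared geometric sums of the others, and \<open>large\<close>
  lets the main term beat all errors, so T > 0.\<close>

lemma ex_hyperbola_point_in_beatty_set:
  fixes \<alpha> \<beta> B :: real and k M :: nat and x z :: int
  defines "\<rho> \<equiv> cos (pi / (2 * \<alpha>)) ^ 2"
  defines "\<kappa> \<equiv> real (2 * k choose k) / 4 ^ k"
  assumes "prime p" "coprime z (int p)" "\<alpha> > 1" "\<beta> < real_of_int x"
    and "1 \<le> x" "x + 2 * int M \<le> int p + 1" "2 * M \<le> p"
    and B: "\<And>j. j \<le> 2 * k \<Longrightarrow> j \<noteq> k \<Longrightarrow> (norm (\<Sum>a<M. cis (2 * pi * (real k - real j) / \<alpha>) ^ a))\<^sup>2 \<le> B"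
    and "0 \<le> B" "\<rho> ^ k \<le> 1"
    and large: "4 * real p * real p powr (3 / 4) + B < (\<kappa> - \<rho> ^ k) * (real M)\<^sup>2"
  shows "\<exists>a<M. \<exists>b<M. \<exists>c<M. \<exists>d<M.
           (x + int a + int b, 1 + int c + int d) \<in> modular_hyperbola p z \<and> x + int a + int b \<in> beatty_set \<alpha> \<beta>"
proof -
  let ?B = "{..<M} \<times> {..<M}"
  let ?E = "2 * real p powr (3 / 4) * (real p * (real M)\<^sup>2)"
  let ?hit = "\<lambda>P Q. (x + int (fst P) + int (snd P), 1 + int (fst Q) + int (snd Q)) \<in> modular_hyperbola p z"
  \<comment> \<open>\<open>t\<close> is affine in n, so frequency j contributes a fixed phase,
    stored in \<open>w j\<close>, times the twist \<open>u j ^ n\<close>.\<close>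
  define t where "t n = pi * ((real_of_int x + real n - \<beta> + 1 / 2) / \<alpha>)" for n :: nat
  define F where "F n = cos (t n) ^ (2 * k) - \<rho> ^ k" for n
  define S where "S u = (\<Sum>P\<in>?B. \<Sum>Q\<in>?B. u ^ (fst P + snd P) * of_bool (?hit P Q))" for u :: complex
  define err where "err u = of_nat p * S u - (of_nat M)\<^sup>2 * (\<Sum>a<M. u ^ a)\<^sup>2" for u :: complex
  define u where "u j = cis (2 * pi * (real k - real j) / \<alpha>)" for j
  define w where "w j = of_real (real (2 * k choose j) / 4 ^ k) * cis (2 * (real k - real j) * t 0)" for j
  define T where "T = (\<Sum>P\<in>?B. \<Sum>Q\<in>?B. F (fst P + snd P) * of_bool (?hit P Q))"
  have err: "norm (err u) \<le> ?E" if "norm u = 1" for u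
    using twisted_hyperbola_count[OF assms(3,4) that assms(7-9)]
    by (simp add: err_def S_def case_prod_beta)
  have F: "complex_of_real (F n) = (\<Sum>j\<le>2 * k. w j * u j ^ n) - of_real (\<rho> ^ k) * 1 ^ n" for n
  proof -
    have "2 * (real k - real j) * t n = 2 * (real k - real j) * t 0 + real n * (2 * pi * (real k - real j) / \<alpha>)" for j
      by (simp add: t_def add_divide_distrib diff_divide_distrib algebra_simps)
    then show ?thesis
      unfolding F_def of_real_diff cos_power_even_expansion
      by (simp add: w_def u_def Complex.DeMoivre cis_mult mult.assoc)
  qed
  have T: "complex_of_real T = (\<Sum>j\<le>2 * k. w j * S (u j)) - of_real (\<rho> ^ k) * S 1"
  proof -
    have bool: "complex_of_real (of_bool A) = of_bool A" for A
      by (cases A) auto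
    have "complex_of_real T = (\<Sum>P\<in>?B. \<Sum>Q\<in>?B. (\<Sum>j\<le>2 * k. w j * (u j ^ (fst P + snd P) * of_bool (?hit P Q)))
        - of_real (\<rho> ^ k) * (1 ^ (fst P + snd P) * of_bool (?hit P Q)))"
      unfolding T_def of_real_sum of_real_mult F bool left_diff_distrib sum_distrib_right mult.assoc ..
    also have "\<dots> = (\<Sum>P\<in>?B. \<Sum>Q\<in>?B. \<Sum>j\<le>2 * k. w j * (u j ^ (fst P + snd P) * of_bool (?hit P Q)))
        - of_real (\<rho> ^ k) * S 1"
      unfolding sum_subtractf S_def sum_distrib_left ..
    also have "(\<Sum>P\<in>?B. \<Sum>Q\<in>?B. \<Sum>j\<le>2 * k. w j * (u j ^ (fst P + snd P) * of_bool (?hit P Q)))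
        = (\<Sum>j\<le>2 * k. w j * S (u j))"
      unfolding S_def sum_distrib_left sum.swap[of _ "{..2 * k}"] ..
    finally show ?thesis .
  qed
  have norm_w: "norm (w j) = real (2 * k choose j) / 4 ^ k" for j
    by (simp add: w_def norm_mult norm_divide norm_power)
  \<comment> \<open>The binomial weights add up to 4^k / 4^k, so the errors are averaged with no
    loss depending on k.\<close>
  have sum_w: "(\<Sum>j\<le>2 * k. norm (w j)) = 1"
    using choose_row_sum[of "2 * k"]
    by (simp add: norm_w power_mult flip: sum_divide_distrib of_nat_sum)
  have wk: "w k = of_real \<kappa>" "u k = 1"
    by (simp_all add: w_def u_def \<kappa>_def)
  have S: "of_nat p * S v = err v + (of_nat M)\<^sup>2 * (\<Sum>a<M. v ^ a)\<^sup>2" for v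
    by (simp add: err_def)
  \<comment> \<open>At the trivial twist the geometric sum is M, which yields the main term.\<close>
  have S1: "of_nat p * S 1 = err 1 + (of_nat M) ^ 4"
    by (simp add: S power_mult_distrib flip: power_add)
  have "of_nat p * complex_of_real T
      = (\<Sum>j\<le>2 * k. w j * (of_nat p * S (u j))) - of_real (\<rho> ^ k) * (of_nat p * S 1)"
    unfolding T by (simp add: right_diff_distrib sum_distrib_left mult_ac)
  also have "(\<Sum>j\<le>2 * k. w j * (of_nat p * S (u j)))
      = of_real \<kappa> * (of_nat p * S 1) + (\<Sum>j\<in>{..2 * k} - {k}. w j * (of_nat p * S (u j)))"
    by (subst sum.remove[of _ k]) (auto simp: wk)
  finally have "complex_of_real (real p * T - (\<kappa> - \<rho> ^ k) * real M ^ 4)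
      = of_real \<kappa> * err 1 + (\<Sum>j\<in>{..2 * k} - {k}. w j * (of_nat p * S (u j))) - of_real (\<rho> ^ k) * err 1"
    unfolding S1 by (simp add: algebra_simps)
  \<comment> \<open>The bound for the constant frequency is padded by the B term, so that all
    frequencies share one bound.\<close>
  moreover have "norm (of_real \<kappa> * err 1) \<le> norm (w k) * (?E + (real M)\<^sup>2 * B)"
    unfolding norm_mult wk(1) using err[of 1] \<open>0 \<le> B\<close>
    by (intro mult_left_mono) (auto intro: add_increasing2)
  moreover have "norm (\<Sum>j\<in>{..2 * k} - {k}. w j * (of_nat p * S (u j)))
      \<le> (\<Sum>j\<in>{..2 * k} - {k}. norm (w j) * (?E + (real M)\<^sup>2 * B))"
  proof (rule sum_norm_le)
    fix j assume j: "j \<in> {..2 * k} - {k}"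
    have "norm (of_nat p * S (u j)) \<le> norm (err (u j)) + (real M)\<^sup>2 * (norm (\<Sum>a<M. u j ^ a))\<^sup>2"
      unfolding S by (rule order_trans[OF norm_triangle_ineq]) (simp add: norm_mult norm_power)
    also have "\<dots> \<le> ?E + (real M)\<^sup>2 * B"
      using j B[of j] by (intro add_mono err mult_left_mono) (auto simp: u_def)
    finally show "norm (w j * (of_nat p * S (u j))) \<le> norm (w j) * (?E + (real M)\<^sup>2 * B)"
      unfolding norm_mult[of "w j"] by (intro mult_left_mono) auto
  qed
  moreover have "norm (w k) * (?E + (real M)\<^sup>2 * B) + (\<Sum>j\<in>{..2 * k} - {k}. norm (w j) * (?E + (real M)\<^sup>2 * B))
      = ?E + (real M)\<^sup>2 * B"
  proof -
    have "norm (w k) * (?E + (real M)\<^sup>2 * B) + (\<Sum>j\<in>{..2 * k} - {k}. norm (w j) * (?E + (real M)\<^sup>2 * B))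
        = (\<Sum>j\<le>2 * k. norm (w j) * (?E + (real M)\<^sup>2 * B))"
      by (subst sum.remove[of "{..2 * k}" k]) auto
    then show ?thesis by (simp only: sum_distrib_right[symmetric] sum_w mult_1)
  qed
  moreover have "norm (of_real (\<rho> ^ k) * err 1) \<le> ?E"
  proof -
    have "norm (of_real (\<rho> ^ k) * err 1) = \<rho> ^ k * norm (err 1)"
      by (simp add: norm_mult norm_power \<rho>_def)
    also have "\<dots> \<le> 1 * ?E"
      using \<open>\<rho> ^ k \<le> 1\<close> err[of 1] by (intro mult_mono) auto
    finally show ?thesis by simp
  qed
  ultimately have "norm (complex_of_real (real p * T - (\<kappa> - \<rho> ^ k) * real M ^ 4)) \<le> 2 * ?E + (real M)\<^sup>2 * B"
    by (smt (verit) norm_triangle_ineq norm_triangle_ineq4)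
  then have "\<bar>real p * T - (\<kappa> - \<rho> ^ k) * real M ^ 4\<bar> \<le> 2 * ?E + (real M)\<^sup>2 * B"
    by (simp only: norm_of_real)
  \<comment> \<open>This is \<open>large\<close> multiplied by M^2; M = 0 would make the nonnegative
    left side of \<open>large\<close> negative.\<close>
  moreover have "2 * ?E + (real M)\<^sup>2 * B < (\<kappa> - \<rho> ^ k) * real M ^ 4"
  proof -
    have "M > 0"
    proof (rule ccontr)
      assume "\<not> M > 0"
      then have "4 * real p * real p powr (3 / 4) + B < 0" using large by simp
      moreover have "0 \<le> 4 * real p * real p powr (3 / 4)" by simp
      ultimately show False using \<open>0 \<le> B\<close> by linarith
    qed
    then have "(4 * real p * real p powr (3 / 4) + B) * (real M)\<^sup>2 < (\<kappa> - \<rho> ^ k) * (real M)\<^sup>2 * (real M)\<^sup>2"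
      by (intro mult_strict_right_mono large) auto
    then show ?thesis by (simp add: algebra_simps power4_eq_xxxx power2_eq_square)
  qed
  ultimately have "real p * T > 0" by linarith
  then have "T > 0"
    by (simp add: zero_less_mult_iff)
  \<comment> \<open>A positive sum has a positive summand, and that summand must be a hit at which
    \<open>F\<close> is positive.\<close>
  then obtain P where P: "P \<in> ?B" "(\<Sum>Q\<in>?B. F (fst P + snd P) * of_bool (?hit P Q)) > 0"
    unfolding T_def by (metis (no_types, lifting) not_le sum_nonpos)
  then obtain Q where Q: "Q \<in> ?B" "F (fst P + snd P) * of_bool (?hit P Q) > 0"
    by (metis (no_types, lifting) not_le sum_nonpos)
  then have hit: "?hit P Q" "F (fst P + snd P) > 0"
    by (auto simp: of_bool_def split: if_splits)
  then have "\<rho> ^ k < (cos (t (fst P + snd P)) ^ 2) ^ k"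
    by (simp add: F_def power_mult)
  then have "\<rho> < cos (t (fst P + snd P)) ^ 2"
    by (rule power_less_imp_less_base) simp
  then have "x + int (fst P) + int (snd P) \<in> beatty_set \<alpha> \<beta>"
    using assms(5,6) by (intro mem_beatty_set_if_cos_gt) (auto simp: t_def \<rho>_def algebra_simps)
  then show ?thesis
    using P(1) Q(1) hit(1) by (auto simp: mem_Times_iff)
qed

text \<open>Irrationality of \<alpha> enters here: at nonzero frequencies the ratio of the geometric
  sum differs from 1, so the sum stays bounded however long it is.\<close>

lemma cis_ne_1_of_irrational:
  fixes \<alpha> :: real
  assumes "\<alpha> \<notin> \<rat>" "h \<noteq> 0"
  shows "cis (2 * pi * real_of_int h / \<alpha>) \<noteq> 1"
proof
  assume "cis (2 * pi * real_of_int h / \<alpha>) = 1"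
  then obtain n where "2 * pi * real_of_int h / \<alpha> = real_of_int n * (2 * pi)"
    by (auto simp: cis_eq_1_iff)
  then have "(2 * pi) * (real_of_int h / \<alpha>) = (2 * pi) * real_of_int n"
    by (simp add: mult.commute)
  then have "real_of_int h / \<alpha> = real_of_int n"
    by (rule mult_left_cancel[THEN iffD1, rotated]) simp
  moreover have "\<alpha> \<noteq> 0" using assms(1) by auto
  ultimately have "\<alpha> = real_of_int h / real_of_int n"
    using assms(2) by (auto simp: field_simps)
  then show False using assms(1) by auto
qed

section \<open>Choice of the parameters and of a threshold uniform in \<beta>\<close>

theorem theorem2p1:
  fixes \<alpha> \<epsilon> :: real
  assumes "\<epsilon> > 0"
    and "\<alpha> > 1"
    and "\<alpha> \<notin> \<rat>"
    and "irrationality_type \<alpha> \<le> ereal (512 / 43 - \<epsilon>)"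
  shows "\<exists>p\<^sub>0::nat. \<forall>\<beta>::real. \<beta> \<ge> 0 \<longrightarrow>
           (\<forall>p::nat. prime p \<and> p \<ge> p\<^sub>0 \<and> \<alpha> + \<beta> < real p \<longrightarrow>
             (\<forall>z::int. coprime z (int p) \<longrightarrow>
               (\<exists>m m'. (m, m') \<in> modular_hyperbola p z \<and> m \<in> beatty_set \<alpha> \<beta> \<and>
                 real_of_int (max m m') \<le> \<alpha> * real p powr (684 / 727) * ln (real p) + \<beta>)))"
proof -
  define \<rho> where "\<rho> = cos (pi / (2 * \<alpha>)) ^ 2"
  \<comment> \<open>The angle lies in (0, \<pi>), so its sine is positive and its squared cosine
    stays below 1.\<close>
  have "0 < pi / (2 * \<alpha>)" "pi / (2 * \<alpha>) < pi"
    using assms(2) by (auto simp: field_simps)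
  then have "0 < sin (pi / (2 * \<alpha>))"
    by (rule sin_gt_zero)
  then have "\<rho> < 1"
    by (simp add: \<rho>_def cos_squared_eq)
  moreover have "0 \<le> \<rho>"
    by (simp add: \<rho>_def)
  ultimately have \<rho>: "0 \<le> \<rho>" "\<rho> < 1" by auto
  \<comment> \<open>This k depends on \<alpha> alone and makes the mean of the trigonometric
    polynomial positive.\<close>
  obtain k where k: "\<rho> ^ k < real (2 * k choose k) / 4 ^ k"
    using ex_central_binomial_gt_power[OF \<rho>] by blast
  define \<kappa> where "\<kappa> = real (2 * k choose k) / 4 ^ k"
  define u where "u j = cis (2 * pi * (real k - real j) / \<alpha>)" for j
  \<comment> \<open>One bound for the finitely many nonconstant frequencies, independent of the
    length M and of \<beta>.\<close>
  define B where "B = (\<Sum>j\<in>{..2 * k} - {k}. (2 / norm (1 - u j))\<^sup>2)"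
  have B: "(norm (\<Sum>a<M. u j ^ a))\<^sup>2 \<le> B" if "j \<le> 2 * k" "j \<noteq> k" for j M
  proof -
    have "u j \<noteq> 1"
      using cis_ne_1_of_irrational[OF assms(3), of "int k - int j"] that by (simp add: u_def)
    then have "(norm (\<Sum>a<M. u j ^ a))\<^sup>2 \<le> (2 / norm (1 - u j))\<^sup>2"
      by (intro power_mono norm_geometric_sum_le) (auto simp: u_def)
    also have "\<dots> \<le> B"
      unfolding B_def using that
      by (intro member_le_sum[of j _ "\<lambda>j. (2 / norm (1 - u j))\<^sup>2"]) auto
    finally show ?thesis .
  qed
  have "B \<ge> 0" by (simp add: B_def sum_nonneg)
  have "\<kappa> - \<rho> ^ k > 0" using k by (simp add: \<kappa>_def)
  define X where "X p = \<alpha> * real p powr (684 / 727) * ln (real p)" for p :: nat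
  \<comment> \<open>X^2 carries the exponent 2 * 684/727 > 7/4 and so outgrows p * p^(3/4);
    \<open>X p / 2 - 1\<close> is a lower bound for the integer M chosen later.\<close>
  have "eventually (\<lambda>p. 4 * real p * real p powr (3 / 4) + B < (\<kappa> - \<rho> ^ k) * (X p / 2 - 1)\<^sup>2) at_top"
    using \<open>\<kappa> - \<rho> ^ k > 0\<close> assms(2) unfolding X_def by real_asymp
  moreover have "eventually (\<lambda>p. X p < real p) at_top"
    using assms(2) unfolding X_def by real_asymp
  moreover have "eventually (\<lambda>p. 2 < X p) at_top"
    using assms(2) unfolding X_def by real_asymp
  ultimately have "eventually (\<lambda>p. 4 * real p * real p powr (3 / 4) + B < (\<kappa> - \<rho> ^ k) * (X p / 2 - 1)\<^sup>2
      \<and> X p < real p \<and> 2 < X p) at_top"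
    by eventually_elim auto
  then obtain p0 where p0: "\<And>p. p \<ge> p0 \<Longrightarrow>
      4 * real p * real p powr (3 / 4) + B < (\<kappa> - \<rho> ^ k) * (X p / 2 - 1)\<^sup>2 \<and> X p < real p \<and> 2 < X p"
    by (auto simp: eventually_at_top_linorder)
  have "\<exists>m m'. (m, m') \<in> modular_hyperbola p z \<and> m \<in> beatty_set \<alpha> \<beta> \<and> real_of_int (max m m') \<le> X p + \<beta>"
    if p: "\<beta> \<ge> 0" "prime p" "p \<ge> p0" "\<alpha> + \<beta> < real p" "coprime z (int p)" for \<beta> p z
  proof (cases "X p + \<beta> < real p")
    case True
    \<comment> \<open>With x the least integer above \<beta>, the abscissa is at most \<beta> + 1 +
      (2 M - 2), which is below X + \<beta>; the ordinate is at most 2 M - 1.\<close>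
    define M where "M = nat \<lfloor>X p / 2\<rfloor>"
    define x where "x = \<lfloor>\<beta>\<rfloor> + 1"
    have M: "2 * real M \<le> X p" "X p / 2 - 1 \<le> real M"
      using p0[OF p(3)] unfolding M_def by linarith+
    have x: "\<beta> < real_of_int x" "real_of_int x \<le> \<beta> + 1" "1 \<le> x"
      using p(1) unfolding x_def by linarith+
    have "real_of_int (x + 2 * int M) < real_of_int (int p + 1)"
      using M(1) x(2) True by simp
    then have xM: "x + 2 * int M \<le> int p + 1"
      by linarith
    have Mp: "2 * M \<le> p"
      using M(1) p0[OF p(3)] by linarith
    have "(X p / 2 - 1)\<^sup>2 \<le> (real M)\<^sup>2"
      using M(2) p0[OF p(3)] by (intro power_mono) auto
    then have "(\<kappa> - \<rho> ^ k) * (X p / 2 - 1)\<^sup>2 \<le> (\<kappa> - \<rho> ^ k) * (real M)\<^sup>2"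
      using \<open>\<kappa> - \<rho> ^ k > 0\<close> by (intro mult_left_mono) auto
    with p0[OF p(3)] have large: "4 * real p * real p powr (3 / 4) + B < (\<kappa> - \<rho> ^ k) * (real M)\<^sup>2"
      by linarith
    obtain a b c d where abcd: "a < M" "b < M" "c < M" "d < M"
      and hit: "(x + int a + int b, 1 + int c + int d) \<in> modular_hyperbola p z"
        "x + int a + int b \<in> beatty_set \<alpha> \<beta>"
      using ex_hyperbola_point_in_beatty_set[OF p(2,5) assms(2) x(1,3) xM Mp B[unfolded u_def] \<open>B \<ge> 0\<close>
        power_le_one[OF \<rho>(1) less_imp_le[OF \<rho>(2)], unfolded \<rho>_def] large[unfolded \<rho>_def \<kappa>_def]]
      by blast
    have "real_of_int (x + int a + int b) \<le> X p + \<beta>" "real_of_int (1 + int c + int d) \<le> X p + \<beta>"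
      using abcd M(1) x(2) p(1) by auto
    then show ?thesis
      using hit by (intro exI[of _ "x + int a + int b"] exI[of _ "1 + int c + int d"]) auto
  next
    case False
    \<comment> \<open>All coordinates are below p \<le> X + \<beta>, so the size bound is automatic.
      The Beatty element with index 1 is enough, and \<alpha> + \<beta> < p makes it an admissible
      abscissa.\<close>
    define m where "m = \<lfloor>\<alpha> + \<beta>\<rfloor>"
    have m: "1 \<le> m" "m < int p"
      using assms(2) p(1,4) unfolding m_def by linarith+
    then obtain m' where "(m, m') \<in> modular_hyperbola p z"
      using modular_hyperbola_unique_ordinate[OF p(2,5)] by blast
    moreover have "m \<in> beatty_set \<alpha> \<beta>"
      unfolding beatty_set_def m_def by (intro CollectI exI[of _ 1]) simp
    moreover have "real_of_int (max m m') \<le> X p + \<beta>"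
    proof -
      have "max m m' < int p"
        using calculation by (auto simp: modular_hyperbola_def)
      then show ?thesis using False by linarith
    qed
    ultimately show ?thesis by blast
  qed
  then show ?thesis
    unfolding X_def by blast
qed

end
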